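(* Let $(p,q)$ be a pair of non-negative integers, not both zero, such that the $(p,q)$-filling of the cusp $c_2$ of $\mathbb{S}^3\setminus 6^2_2$ is a hyperbolic Dehn filling, with resulting orbifold $M$, and let $(\sigma_1,\sigma_2)$ be a point corresponding to this $(p,q)$-hyperbolic Dehn filling of $c_2$. Then the invariant trace field and the trace field of $M$ both equal $\mathbb{Q}(\sigma_2)$.
   Context: $6^2_2$ is the link so named in Rolfsen's table: a hyperbolic two-component two-bridge link (type $3/10$), with cusps $c_1,c_2$ of its complement exchanged by an involution. For $(p,q)\in\mathbb{Z}^2\setminus\{(0,0)\}$ with $k=\gcd(p,q)$, the $(p,q)$-filling of $c_2$ (with respect to the standard meridian $\mu$ and null-homologous longitude $\lambda$ of the link component) replaces $c_2$ by a solid torus whose meridian is glued to $\frac{p}{k}[\mu]+\frac{q}{k}[\lambda]$ and whose core is a cone singularity of order $k$; $c_1$ stays unfilled. The fillings $(\pm p,\pm q)$ are all homeomorphic, so $p,q\geq0$ is assumed. Let $V_0=\{(w,x)\in\mathbb{C}^2: 1-x(1-x)w(1-w)=0\}$. A point $(w,x)\in V_0$ determines a (generally incomplete) hyperbolic structure on $\mathbb{S}^3\setminus 6^2_2$ with $c_1$ complete, as follows. In upper half-space take the four ideal tetrahedra with vertex sets $\{0,1,x,\infty\}$, $\{x,1,1+x,\infty\}$, $\{1+x,x+w,x,\infty\}$, $\{1+x+w,x+w,1+x,\infty\}$, glued along shared faces to a decahedron, and pair its remaining faces by the orientation-preserving isometries determined by: $(0,x,\infty)\mapsto(1,1+x,\infty)$;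 $(x,x+w,\infty)\mapsto(1+x,1+x+w,\infty)$; $(0,1,\infty)\mapsto(x+w,1+x+w,\infty)$; $(0,1,x)\mapsto(1+x+w,1+x,x+w)$; $(1,1+x,x)\mapsto(x,x+w,1+x)$. The vertex $\infty$ corresponds to $c_1$ and all others to $c_2$. The complete structure is $w=x=\frac12(1+\sqrt{-3})$. The point $(w,x)$ corresponds to $(p,q)$-hyperbolic Dehn filling of $c_2$ if the completion of this structure is the complete hyperbolic structure on the $(p,q)$-filling (so the holonomy representation factors through the orbifold fundamental group of the filling as its holonomy); in particular it then satisfies $\left[\frac{x(1-w)}{w(1-x)}\right]^p\left[\frac{w(1-w)}{x(1-x)}\right]^q=1$. Put $\sigma_1=w+x$, $\sigma_2=wx$; then $(\sigma_1,\sigma_2)$ is said to correspond to the filling if $(w,x)$ does, and $1+\sigma_1\sigma_2-\sigma_2-\sigma_2^2=0$. The trace field of a Kleinian group $\Gamma\subset\mathrm{PSL}(2,\mathbb{C})$ is generated over $\mathbb{Q}$ by the traces (of lifts to $\mathrm{SL}(2,\mathbb{C})$) of its elements; the invariant trace field is the trace field of the subgroup generated by squares. *)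

theory Defs
  imports "HOL-Analysis.Analysis" "HOL-Algebra.Generated_Fields"
    "HOL-Algebra.Algebraic_Closure_Type"
begin

section \<open>\<open>PSL(2,C)\<close> and its actions\<close>

type_synonym mat2 = "complex^2^2"

abbreviation entry :: "mat2 \<Rightarrow> 2 \<Rightarrow> 2 \<Rightarrow> complex" where
  "entry A i j \<equiv> vec_nth (vec_nth A i) j"

definition SL2 :: "mat2 monoid" where
  "SL2 = \<lparr>carrier = {A. det A = 1}, monoid.mult = (**), one = mat 1\<rparr>"

definition PSL2 :: "mat2 set monoid" where
  "PSL2 = SL2 Mod {mat 1, - mat 1}"

text \<open>The Riemann sphere is \<open>complex option\<close>, with \<open>None\<close> as the point at infinity.\<close>

fun moebius :: "mat2 \<Rightarrow> complex option \<Rightarrow> complex option" where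
  "moebius A None = (if entry A 2 1 = 0 then None else Some (entry A 1 1 / entry A 2 1))"
| "moebius A (Some z) =
     (if entry A 2 1 * z + entry A 2 2 = 0 then None
      else Some ((entry A 1 1 * z + entry A 1 2) / (entry A 2 1 * z + entry A 2 2)))"

type_synonym point = "complex \<times> real"

definition H3 :: "point set" where
  "H3 = {(z, t). 0 < t}"

text \<open>Poincare extension of a Moebius transformation to upper half-space.\<close>

fun poincare :: "mat2 \<Rightarrow> point \<Rightarrow> point" where
  "poincare A (z, t) =
     (let N = (cmod (entry A 2 1 * z + entry A 2 2))\<^sup>2 + (cmod (entry A 2 1))\<^sup>2 * t\<^sup>2
      in (((entry A 1 1 * z + entry A 1 2) * cnj (entry A 2 1 * z + entry A 2 2)
            + entry A 1 1 * cnj (entry A 2 1) * of_real (t\<^sup>2)) / of_real N,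
          t / N))"

text \<open>Both actions are unchanged when a matrix is replaced by its negative, so the choice of
  representative below is immaterial.\<close>

definition sphere_act :: "mat2 set \<Rightarrow> complex option \<Rightarrow> complex option" where
  "sphere_act g = moebius (SOME A. A \<in> g)"

definition H3_act :: "mat2 set \<Rightarrow> point \<Rightarrow> point" where
  "H3_act g = poincare (SOME A. A \<in> g)"

definition geodesic :: "point set \<Rightarrow> bool" where
  "geodesic l \<longleftrightarrow> (\<exists>g\<in>carrier PSL2. l = H3_act g ` {(0, t) | t. 0 < t})"

text \<open>The map \<open>(z, t) \<mapsto> (z, |z|\<^sup>2 + t\<^sup>2)\<close> carries hyperbolic geodesics to straight segments (a
  projective model with a paraboloid as its boundary), an ideal point \<open>a\<close> to \<open>(a, |a|\<^sup>2)\<close>, and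
  infinity to the vertical direction. Hyperbolic convex hulls of ideal points are therefore
  Euclidean ones in these coordinates; the ideal points themselves are left out.\<close>

definition ideal_hull :: "complex option set \<Rightarrow> point set" where
  "ideal_hull V = {(z, t). 0 < t \<and>
     (\<exists>h s. h \<in> convex hull ((\<lambda>a. (a, (cmod a)\<^sup>2)) ` {a. Some a \<in> V}) \<and>
            0 \<le> s \<and> (None \<notin> V \<longrightarrow> s = 0) \<and>
            (z, (cmod z)\<^sup>2 + t\<^sup>2) = h + (0, s))}"


section \<open>The decahedron and its face pairings\<close>

definition V0 :: "(complex \<times> complex) set" where
  "V0 = {(w, x). 1 - x * (1 - x) * w * (1 - w) = 0}"

definition tetrahedra :: "complex \<Rightarrow> complex \<Rightarrow> complex option list list" where
  "tetrahedra w x =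
    [[Some 0, Some 1, Some x, None],
     [Some x, Some 1, Some (1 + x), None],
     [Some (1 + x), Some (x + w), Some x, None],
     [Some (1 + x + w), Some (x + w), Some (1 + x), None]]"

datatype pairing = PA | PB | PC | PD | PE

fun source_face :: "complex \<Rightarrow> complex \<Rightarrow> pairing \<Rightarrow> complex option list" where
  "source_face w x PA = [Some 0, Some x, None]"
| "source_face w x PB = [Some x, Some (x + w), None]"
| "source_face w x PC = [Some 0, Some 1, None]"
| "source_face w x PD = [Some 0, Some 1, Some x]"
| "source_face w x PE = [Some 1, Some (1 + x), Some x]"

fun target_face :: "complex \<Rightarrow> complex \<Rightarrow> pairing \<Rightarrow> complex option list" where
  "target_face w x PA = [Some 1, Some (1 + x), None]"
| "target_face w x PB = [Some (1 + x), Some (1 + x + w), None]"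
| "target_face w x PC = [Some (x + w), Some (1 + x + w), None]"
| "target_face w x PD = [Some (1 + x + w), Some (1 + x), Some (x + w)]"
| "target_face w x PE = [Some x, Some (x + w), Some (1 + x)]"

definition pairs_faces :: "complex \<Rightarrow> complex \<Rightarrow> pairing \<Rightarrow> mat2 set \<Rightarrow> bool" where
  "pairs_faces w x j g \<longleftrightarrow>
     g \<in> carrier PSL2 \<and> map (sphere_act g) (source_face w x j) = target_face w x j"

text \<open>The complete structure is \<open>w = x = \<omega>\<close>; it serves as the model of the link complement:
  \<open>S\<^sup>3 - 6\<^sup>2\<^sub>2\<close> is \<open>decahedron\<close> modulo \<open>glued\<close>.\<close>

definition \<omega> :: complex where
  "\<omega> = Complex (1/2) (sqrt 3 / 2)"

definition decahedron :: "point set" where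
  "decahedron = (\<Union>T\<in>set (tetrahedra \<omega> \<omega>). ideal_hull (set T))"

definition glued :: "(point \<times> point) set" where
  "glued =
     (let r = {(y, H3_act g y) | j g y.
                 pairs_faces \<omega> \<omega> j g \<and> y \<in> ideal_hull (set (source_face \<omega> \<omega> j))}
      in (r \<union> r\<inverse>)\<^sup>*)"


section \<open>Representations of the link group\<close>

text \<open>The link group is generated by the five face pairings (it is the deck group of the
  tessellation of \<open>H\<^sup>3\<close> by copies of \<open>decahedron\<close>), so a representation is given by its values on
  them. In a word, the flag \<open>False\<close> stands for the inverse of the generator.\<close>

fun hol_word :: "(pairing \<Rightarrow> mat2 set) \<Rightarrow> (pairing \<times> bool) list \<Rightarrow> mat2 set" where
  "hol_word \<phi> [] = \<one>\<^bsub>PSL2\<^esub>"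
| "hol_word \<phi> ((j, b) # u) = (if b then \<phi> j else inv\<^bsub>PSL2\<^esub> (\<phi> j)) \<otimes>\<^bsub>PSL2\<^esub> hol_word \<phi> u"

definition holonomy_group :: "(pairing \<Rightarrow> mat2 set) \<Rightarrow> mat2 set set" where
  "holonomy_group \<phi> = generate PSL2 (range \<phi>)"

text \<open>Meridian and longitude of \<open>c\<^sub>2\<close>, based at the vertex \<open>x\<close>. For the representation attached to a
  point \<open>(w, x)\<close> of \<open>V0\<close> they fix the ideal point \<open>x\<close>, with derivatives there
  \<open>x(1-w) / (w(1-x))\<close> and \<open>w(1-w) / (x(1-x))\<close>.
  The edge cycles of the decahedron give \<open>B = A\<close>, \<open>D = E\<^sup>2\<close>, \<open>C = E\<^sup>2 A\<^sup>-\<^sup>1 E\<^sup>-\<^sup>1 A\<^sup>-\<^sup>1 E\<^sup>2\<close> and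
  \<open>[A, C] = 1\<close>. Adding the relation \<open>meridian = 1\<close> leaves an infinite cyclic group, and
  \<open>longitude\<close> is homologous to \<open>3 A\<close>, where \<open>A\<close> is the class of a meridian of the other component:
  it is null-homologous in the complement of its own component, the linking number being 3 up to
  sign.\<close>

definition meridian :: "(pairing \<times> bool) list" where
  "meridian = [(PA, False), (PE, True)]"

definition longitude :: "(pairing \<times> bool) list" where
  "longitude = [(PE, True), (PA, True), (PC, False), (PD, True)]"


section \<open>Hyperbolic Dehn filling\<close>

text \<open>\<open>complete_filling p q \<phi> F\<close>: the quotient \<open>M\<close> of \<open>H\<^sup>3\<close> by the Kleinian group
  \<open>\<Gamma> = holonomy_group \<phi>\<close> is the \<open>(p,q)\<close>-filling of \<open>c\<^sub>2\<close>, the link complement being embedded in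
  \<open>M\<close> as the complement of the core. \<open>F\<close> is the restriction to \<open>decahedron\<close> of the developing map
  of the link complement with the hyperbolic structure it inherits from \<open>M\<close>, and \<open>\<phi>\<close> is its
  holonomy. In detail:

  The lifts of the core are the \<open>\<Gamma>\<close>-translates of a geodesic \<open>l\<close>, and \<open>U\<close> is their complement. The
  group acts freely on \<open>U\<close>, and \<open>F\<close> induces a continuous bijection from the link complement to
  \<open>U / \<Gamma>\<close>; by invariance of domain it is a homeomorphism. It takes the end \<open>c\<^sub>2\<close> to the end of the
  core, because the peripheral group of \<open>c\<^sub>2\<close> preserves \<open>l\<close>. The curves on the boundary torus of a
  tubular neighbourhood of the core that lift to closed curves around \<open>l\<close> are exactly the multiples
  of \<open>p\<mu> + q\<lambda>\<close>; with \<open>k = gcd p q\<close> this says that \<open>(p/k)\<mu> + (q/k)\<lambda>\<close> bounds the meridian disc and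
  that the cone order along the core is \<open>k\<close>.\<close>

definition complete_filling ::
    "nat \<Rightarrow> nat \<Rightarrow> (pairing \<Rightarrow> mat2 set) \<Rightarrow> (point \<Rightarrow> point) \<Rightarrow> bool" where
  "complete_filling p q \<phi> F \<longleftrightarrow>
     range \<phi> \<subseteq> carrier PSL2 \<and>
     discrete (\<Union> (holonomy_group \<phi>)) \<and>
     (\<exists>l. geodesic l \<and>
        H3_act (hol_word \<phi> meridian) ` l = l \<and>
        H3_act (hol_word \<phi> longitude) ` l = l \<and>
        (\<forall>a b :: int.
           hol_word \<phi> meridian [^]\<^bsub>PSL2\<^esub> a \<otimes>\<^bsub>PSL2\<^esub> hol_word \<phi> longitude [^]\<^bsub>PSL2\<^esub> b = \<one>\<^bsub>PSL2\<^esub>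
           \<longleftrightarrow> (\<exists>n :: int. a = n * int p \<and> b = n * int q)) \<and>
        (let U = H3 - (\<Union>\<gamma>\<in>holonomy_group \<phi>. H3_act \<gamma> ` l) in
           (\<forall>\<gamma>\<in>holonomy_group \<phi>. \<forall>y\<in>U. H3_act \<gamma> y = y \<longrightarrow> \<gamma> = \<one>\<^bsub>PSL2\<^esub>) \<and>
           continuous_on decahedron F \<and>
           (\<forall>j g. pairs_faces \<omega> \<omega> j g \<longrightarrow>
              (\<forall>y\<in>ideal_hull (set (source_face \<omega> \<omega> j)). F (H3_act g y) = H3_act (\<phi> j) (F y))) \<and>
           (\<Union>\<gamma>\<in>holonomy_group \<phi>. H3_act \<gamma> ` F ` decahedron) = U \<and>
           (\<forall>y\<in>decahedron. \<forall>y'\<in>decahedron. \<forall>\<gamma>\<in>holonomy_group \<phi>.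
              H3_act \<gamma> (F y) = F y' \<longrightarrow> (y, y') \<in> glued)))"

text \<open>\<open>determines w x \<phi> F\<close>: the hyperbolic structure on the link complement with developing map
  \<open>F\<close> and holonomy \<open>\<phi>\<close> is the one determined by \<open>(w, x)\<close>. A structure fixes \<open>\<phi>\<close> and \<open>F\<close> only up to
  an isometry \<open>h\<close> of \<open>H\<^sup>3\<close>. If all tetrahedra are positively oriented, the (straight) developing map
  takes each tetrahedron, face by face, to the one with the prescribed ideal vertices. At other points of \<open>V0\<close> the gluing
  of the tetrahedra is only formal, and the structure is determined through its holonomy; the
  orientation of \<open>F\<close> is left free, so mirror images are included.\<close>

definition determines ::
    "complex \<Rightarrow> complex \<Rightarrow> (pairing \<Rightarrow> mat2 set) \<Rightarrow> (point \<Rightarrow> point) \<Rightarrow> bool" where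
  "determines w x \<phi> F \<longleftrightarrow>
     (w, x) \<in> V0 \<and>
     (\<exists>h\<in>carrier PSL2.
        (\<forall>j. pairs_faces w x j (h \<otimes>\<^bsub>PSL2\<^esub> \<phi> j \<otimes>\<^bsub>PSL2\<^esub> inv\<^bsub>PSL2\<^esub> h)) \<and>
        (0 < Im w \<and> 0 < Im x \<longrightarrow>
           (\<forall>i<4. \<forall>I. H3_act h ` F ` ideal_hull (set (nths (tetrahedra \<omega> \<omega> ! i) I))
                     = ideal_hull (set (nths (tetrahedra w x ! i) I)))))"

definition sigma_determines ::
    "complex \<Rightarrow> complex \<Rightarrow> (pairing \<Rightarrow> mat2 set) \<Rightarrow> (point \<Rightarrow> point) \<Rightarrow> bool" where
  "sigma_determines \<sigma>1 \<sigma>2 \<phi> F \<longleftrightarrow>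
     (\<exists>w x. \<sigma>1 = w + x \<and> \<sigma>2 = w * x \<and> determines w x \<phi> F)"


section \<open>Trace fields\<close>

text \<open>A subfield of \<open>\<complex>\<close> generated by a set already contains \<open>\<rat>\<close>.\<close>

definition adjoin_rat :: "complex set \<Rightarrow> complex set" where
  "adjoin_rat S = generate_field ring_of_type_algebra S"

definition trace_field :: "mat2 set set \<Rightarrow> complex set" where
  "trace_field \<Gamma> = adjoin_rat {trace A | A g. g \<in> \<Gamma> \<and> A \<in> g}"

definition invariant_trace_field :: "mat2 set set \<Rightarrow> complex set" where
  "invariant_trace_field \<Gamma> = trace_field (generate PSL2 {g \<otimes>\<^bsub>PSL2\<^esub> g | g. g \<in> \<Gamma>})"

end

theory Submission
  imports Defs
begin

text \<open>After conjugation \<open>PA\<close> and \<open>PB\<close> become translations by 1, \<open>PC\<close> one by \<open>\<sigma>1\<close>, and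
  \<open>PE\<close> becomes a matrix \<open>E\<close> of determinant 1 with trace \<open>\<sigma>2\<close> and lower left entry
  \<open>s = \<sigma>1 - \<sigma>2\<close>, while \<open>PD\<close> becomes \<open>E\<^sup>2\<close>. On \<open>V0\<close> we have \<open>s \<sigma>2 = \<sigma>2 - 1\<close>, so \<open>s\<close> and
  \<open>\<sigma>1\<close> lie in \<open>K = \<rat>(\<sigma>2)\<close>. Let \<open>T\<close> be the translation by 1 and \<open>N = T - 1\<close>.
  The identities \<open>N\<^sup>2 = 0\<close>, \<open>E\<^sup>2 = \<sigma>2 E - 1\<close> and \<open>E N = \<sigma>2 N + s - N E\<close> show that the
  \<open>K\<close>-span of \<open>1, N, E, N E\<close> is an algebra; it contains the group, and all its
  traces lie in \<open>K\<close>. Conversely, \<open>tr E = \<sigma>2\<close>, and the squares of the generators already give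
  \<open>tr (T\<^sup>2 E\<^sup>2) - tr E\<^sup>2 = 2 s \<sigma>2 = 2 (\<sigma>2 - 1)\<close>.\<close>

section \<open>Matrices of \<open>SL(2,C)\<close> and \<open>PSL(2,C)\<close>\<close>

lemma mat2_eq_iff:
  "(A :: mat2) = B \<longleftrightarrow> entry A 1 1 = entry B 1 1 \<and> entry A 1 2 = entry B 1 2
      \<and> entry A 2 1 = entry B 2 1 \<and> entry A 2 2 = entry B 2 2"
  by (auto simp: vec_eq_iff forall_2)

lemma mat2_mult_entry: "entry (A ** B) i j = entry A i 1 * entry B 1 j + entry A i 2 * entry B 2 j"
  by (simp add: matrix_matrix_mult_def sum_2)

lemma mat2_one_entry:
  "entry (mat 1) 1 1 = 1" "entry (mat 1) 1 2 = 0" "entry (mat 1) 2 1 = 0" "entry (mat 1) 2 2 = 1"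
  by (simp_all add: mat_def)

lemma mat2_trace: "trace (A :: mat2) = entry A 1 1 + entry A 2 2"
  by (simp add: trace_def sum_2)

definition mat22 :: "complex \<Rightarrow> complex \<Rightarrow> complex \<Rightarrow> complex \<Rightarrow> mat2" where
  "mat22 a b c d = vector [vector [a, b], vector [c, d]]"

lemma mat22_entry [simp]:
  "entry (mat22 a b c d) 1 1 = a" "entry (mat22 a b c d) 1 2 = b"
  "entry (mat22 a b c d) 2 1 = c" "entry (mat22 a b c d) 2 2 = d"
  by (simp_all add: mat22_def)

definition adj2 :: "mat2 \<Rightarrow> mat2" where
  "adj2 A = mat22 (entry A 2 2) (- entry A 1 2) (- entry A 2 1) (entry A 1 1)"

lemma mat2_minus_mult [simp]:
  "(- A) ** B = - (A ** B)" "A ** (- B) = - (A ** B)" for A B :: mat2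
  by (simp_all add: mat2_eq_iff mat2_mult_entry)

lemma det_uminus_mat2 [simp]: "det (- A) = det A" for A :: mat2
  by (simp add: det_2)

lemma det_adj2 [simp]: "det (adj2 A) = det A"
  by (simp add: det_2 adj2_def)

lemma adj2_mult:
  assumes "det A = 1" shows "adj2 A ** A = mat 1" "A ** adj2 A = mat 1"
  using assms by (simp_all add: mat2_eq_iff mat2_mult_entry mat2_one_entry det_2 adj2_def algebra_simps)

lemma group_SL2: "group SL2"
proof (rule groupI)
  fix A assume "A \<in> carrier SL2"
  then show "\<exists>B\<in>carrier SL2. B \<otimes>\<^bsub>SL2\<^esub> A = \<one>\<^bsub>SL2\<^esub>"
    by (intro bexI[of _ "adj2 A"]) (auto simp: SL2_def adj2_mult)
qed (auto simp: SL2_def det_mul matrix_mul_assoc)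

lemma SL2_inv:
  assumes "det A = 1" shows "inv\<^bsub>SL2\<^esub> A = adj2 A"
  by (rule group.inv_equality[OF group_SL2]) (use assms in \<open>auto simp: SL2_def adj2_mult\<close>)

text \<open>Both elements are scalar matrices, hence central, so conjugation fixes each of
  them.\<close>

lemma normal_pm_one: "{mat 1, - mat 1} \<lhd> SL2"
proof -
  interpret group SL2 by (rule group_SL2)
  have "subgroup {mat 1, - mat 1} SL2"
  proof (rule subgroupI)
    show "inv\<^bsub>SL2\<^esub> A \<in> {mat 1, - mat 1}" if "A \<in> {mat 1, - mat 1}" for A
    proof -
      have "inv\<^bsub>SL2\<^esub> A = adj2 A" using that by (intro SL2_inv) auto
      then show ?thesis using that by (auto simp: adj2_def mat2_eq_iff mat2_one_entry)
    qed
  qed (auto simp: SL2_def)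
  then show ?thesis
    by (simp add: normal_inv_iff) (auto simp: SL2_def SL2_inv[unfolded SL2_def] adj2_mult)
qed

lemma group_PSL2: "group PSL2"
  unfolding PSL2_def by (rule normal.factorgroup_is_group[OF normal_pm_one])

interpretation PSL2: group PSL2 by (rule group_PSL2)

text \<open>Cosets are written as explicit pairs so that computations in the quotient can be done on
  one representative matrix.\<close>

abbreviation pm :: "mat2 \<Rightarrow> mat2 set" where "pm A \<equiv> {A, - A}"

lemma carrier_PSL2: "carrier PSL2 = pm ` {A. det A = 1}"
  by (auto simp: PSL2_def carrier_FactGroup SL2_def r_coset_def image_iff)

lemma pm_in_PSL2: "det A = 1 \<Longrightarrow> pm A \<in> carrier PSL2"
  by (simp add: carrier_PSL2)

lemma PSL2_memE:
  assumes "g \<in> carrier PSL2" "A \<in> g"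
  shows "det A = 1" "g = pm A"
  using assms by (auto simp: carrier_PSL2)

lemma PSL2_obtain:
  assumes "g \<in> carrier PSL2"
  obtains A where "det A = 1" "g = pm A"
  using assms by (auto simp: carrier_PSL2)

lemma PSL2_one: "\<one>\<^bsub>PSL2\<^esub> = pm (mat 1)"
  by (simp add: PSL2_def)

lemma PSL2_mult: "pm A \<otimes>\<^bsub>PSL2\<^esub> pm B = pm (A ** B)"
  by (auto simp: PSL2_def set_mult_def SL2_def)

lemma PSL2_inv:
  assumes "det A = 1" shows "inv\<^bsub>PSL2\<^esub> (pm A) = pm (adj2 A)"
  by (rule PSL2.inv_equality) (use assms in \<open>simp_all add: PSL2_mult adj2_mult PSL2_one pm_in_PSL2\<close>)

section \<open>Subfields of the complex numbers\<close>

abbreviation complex_subfield :: "complex set \<Rightarrow> bool" where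
  "complex_subfield K \<equiv> subfield K ring_of_type_algebra"

lemma field_complex: "field (ring_of_type_algebra :: complex ring)"
  by (rule field_from_type_algebra)

lemma subfield_adjoin_rat: "complex_subfield (adjoin_rat S)"
  unfolding adjoin_rat_def
  by (rule field.generate_field_is_subfield[OF field_complex]) (simp add: ring_of_type_algebra_def)

lemma adjoin_rat_incl: "S \<subseteq> adjoin_rat S"
  by (auto simp: adjoin_rat_def intro: generate_field.incl)

lemma adjoin_rat_minimal:
  assumes "complex_subfield K" "S \<subseteq> K" shows "adjoin_rat S \<subseteq> K"
  unfolding adjoin_rat_def
  by (rule field.generate_field_min_subfield1[OF field_complex])
     (use assms in \<open>auto simp: ring_of_type_algebra_def\<close>)

text \<open>Closure is restated for the ordinary operations on complex numbers in place of those of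
  the ring record; only the additive and multiplicative inverses need an identification.\<close>

context
  fixes K assumes K: "complex_subfield K"
begin

lemma subfield_one: "1 \<in> K"
  using subringE(3)[OF subfieldE(1)[OF K]] by (simp add: ring_of_type_algebra_def)

lemma subfield_zero: "0 \<in> K"
  using subringE(2)[OF subfieldE(1)[OF K]] by (simp add: ring_of_type_algebra_def)

lemma subfield_add: "a \<in> K \<Longrightarrow> b \<in> K \<Longrightarrow> a + b \<in> K"
  using subringE(7)[OF subfieldE(1)[OF K]] by (simp add: ring_of_type_algebra_def)

lemma subfield_mult: "a \<in> K \<Longrightarrow> b \<in> K \<Longrightarrow> a * b \<in> K"
  using subringE(6)[OF subfieldE(1)[OF K]] by (simp add: ring_of_type_algebra_def)

lemma subfield_uminus:
  assumes "a \<in> K" shows "- a \<in> K"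
proof -
  interpret field "ring_of_type_algebra :: complex ring" by (rule field_complex)
  have "\<ominus>\<^bsub>ring_of_type_algebra\<^esub> a = - a"
    by (rule minus_equality) (auto simp: ring_of_type_algebra_def)
  then show ?thesis using subringE(5)[OF subfieldE(1)[OF K] assms] by simp
qed

lemma subfield_diff: "a \<in> K \<Longrightarrow> b \<in> K \<Longrightarrow> a - b \<in> K"
  using subfield_add[of a "- b"] subfield_uminus[of b] by simp

lemma subfield_divide:
  assumes "a \<in> K" "b \<in> K" shows "a / b \<in> K"
\<comment> \<open>By convention \<open>a / 0 = 0\<close>, which also lies in
  \<open>K\<close>.\<close>
proof (cases "b = 0")
  case True
  then show ?thesis by (simp add: subfield_zero)
next
  case False
  interpret field "ring_of_type_algebra :: complex ring" by (rule field_complex)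
  have "inv\<^bsub>ring_of_type_algebra\<^esub> b = inverse b"
    by (rule comm_inv_char) (auto simp: ring_of_type_algebra_def False)
  then have "inverse b \<in> K"
    using subfield_m_inv(1)[OF K, of b] assms(2) False by (simp add: ring_of_type_algebra_def)
  then show ?thesis using subfield_mult assms(1) by (simp add: divide_inverse)
qed

lemmas subfield_closed =
  subfield_one subfield_zero subfield_add subfield_mult subfield_uminus subfield_diff subfield_divide

end

section \<open>The three-point argument\<close>

text \<open>Cross-multiplied form of \<open>moebius M p = q\<close>. Being linear in \<open>M\<close>, it can be checked without
  knowing that denominators do not vanish.\<close>

fun sends :: "mat2 \<Rightarrow> complex option \<Rightarrow> complex option \<Rightarrow> bool" where
  "sends M None None \<longleftrightarrow> entry M 2 1 = 0"
| "sends M None (Some q) \<longleftrightarrow> entry M 1 1 = q * entry M 2 1"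
| "sends M (Some z) None \<longleftrightarrow> entry M 2 1 * z + entry M 2 2 = 0"
| "sends M (Some z) (Some q) \<longleftrightarrow>
     entry M 1 1 * z + entry M 1 2 = q * (entry M 2 1 * z + entry M 2 2)"

lemma moebius_sends: "sends M p (moebius M p)"
  by (cases p) (auto simp: field_simps)

lemma quadratic_three_roots:
  fixes a b c :: complex
  assumes "z1 \<noteq> z2" "z1 \<noteq> z3" "z2 \<noteq> z3"
    "a * z1\<^sup>2 + b * z1 + c = 0" "a * z2\<^sup>2 + b * z2 + c = 0" "a * z3\<^sup>2 + b * z3 + c = 0"
  shows "a = 0 \<and> b = 0 \<and> c = 0"
proof -
  have "(z1 - z2) * (a * (z1 + z2) + b) = 0" "(z1 - z3) * (a * (z1 + z3) + b) = 0"
    using assms(4-6) by Groebner_Basis.algebra+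
  then have 12: "a * (z1 + z2) + b = 0" "a * (z1 + z3) + b = 0" using assms(1,2) by auto
  then have "a * (z2 - z3) = 0" by Groebner_Basis.algebra
  then have "a = 0" using assms(3) by simp
  then show ?thesis using 12 assms(4) by simp
qed

text \<open>The three equations say that \<open>adj2 B ** A\<close> is scalar: they concern its
  lower left entry, its equal diagonal entries and its upper right entry. Hence \<open>A\<close> is
  a multiple of \<open>B\<close>, and the determinants leave only the factors 1 and -1.\<close>

lemma proportional_det_one:
  assumes "det A = 1" "det B = 1"
    and 1: "entry A 1 1 * entry B 2 1 = entry B 1 1 * entry A 2 1"
    and 2: "entry A 1 1 * entry B 2 2 + entry A 1 2 * entry B 2 1
              = entry B 1 1 * entry A 2 2 + entry B 1 2 * entry A 2 1"
    and 3: "entry A 1 2 * entry B 2 2 = entry B 1 2 * entry A 2 2"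
  shows "A \<in> pm B"
proof -
  define l where "l = entry B 2 2 * entry A 1 1 - entry B 1 2 * entry A 2 1"
  have d: "entry A 1 1 * entry A 2 2 - entry A 1 2 * entry A 2 1 = 1"
    "entry B 1 1 * entry B 2 2 - entry B 1 2 * entry B 2 1 = 1"
    using assms(1,2) by (simp_all add: det_2)
  have e: "entry A 1 1 = l * entry B 1 1" "entry A 1 2 = l * entry B 1 2"
    "entry A 2 1 = l * entry B 2 1" "entry A 2 2 = l * entry B 2 2"
  proof -
    show "entry A 1 1 = l * entry B 1 1" unfolding l_def using d(2) 1 by Groebner_Basis.algebra
    \<comment> \<open>The scalar is read off from the other diagonal entry of
      \<open>adj2 B ** A\<close>, which suits the second column.\<close>
    have l: "l = entry B 1 1 * entry A 2 2 - entry A 1 2 * entry B 2 1"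
      using 2 by (simp add: l_def algebra_simps)
    show "entry A 1 2 = l * entry B 1 2" unfolding l using d(2) 3 by Groebner_Basis.algebra
    show "entry A 2 1 = l * entry B 2 1" unfolding l_def using d(2) 1 by Groebner_Basis.algebra
    show "entry A 2 2 = l * entry B 2 2" unfolding l using d(2) 3 by Groebner_Basis.algebra
  qed
  have "l\<^sup>2 * (entry B 1 1 * entry B 2 2 - entry B 1 2 * entry B 2 1) = 1"
    using d(1) unfolding e by Groebner_Basis.algebra
  then have "l = 1 \<or> l = -1" using d(2) by (simp add: power2_eq_1_iff)
  then show ?thesis using e by (auto simp: mat2_eq_iff)
qed

text \<open>Points where two Moebius maps agree are roots of a polynomial of degree at most 2, so
  three of them force it to vanish. Only the third point may be infinity, matching the order in
  which the faces list their vertices.\<close>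

lemma sends_unique:
  assumes "list_all2 (sends A) [Some z1, Some z2, p] qs"
    and "list_all2 (sends B) [Some z1, Some z2, p] qs"
    and det: "det A = 1" "det B = 1" and distinct: "z1 \<noteq> z2" "p \<noteq> Some z1" "p \<noteq> Some z2"
  shows "A \<in> pm B"
proof -
  obtain q1 q2 q3 where A: "sends A (Some z1) q1" "sends A (Some z2) q2" "sends A p q3"
    and B: "sends B (Some z1) q1" "sends B (Some z2) q2" "sends B p q3"
    using assms(1,2) by (auto simp: list_all2_Cons1)
  \<comment> \<open>Coefficients of the cross-multiplied difference
    \<open>(A11 z + A12)(B21 z + B22) - (B11 z + B12)(A21 z + A22)\<close>.\<close>
  define a b c where
    "a = entry A 1 1 * entry B 2 1 - entry B 1 1 * entry A 2 1"
    and "b = entry A 1 1 * entry B 2 2 + entry A 1 2 * entry B 2 1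
              - (entry B 1 1 * entry A 2 2 + entry B 1 2 * entry A 2 1)"
    and "c = entry A 1 2 * entry B 2 2 - entry B 1 2 * entry A 2 2"
  have root: "a * z\<^sup>2 + b * z + c = 0" if "sends A (Some z) q" "sends B (Some z) q" for z q
  proof (cases q)
    case None
    then have "entry A 2 1 * z + entry A 2 2 = 0" "entry B 2 1 * z + entry B 2 2 = 0"
      using that by auto
    then show ?thesis unfolding a_def b_def c_def by Groebner_Basis.algebra
  next
    case (Some y)
    then have "entry A 1 1 * z + entry A 1 2 = y * (entry A 2 1 * z + entry A 2 2)"
      "entry B 1 1 * z + entry B 1 2 = y * (entry B 2 1 * z + entry B 2 2)"
      using that by auto
    then show ?thesis unfolding a_def b_def c_def by Groebner_Basis.algebra
  qed
  have "a = 0 \<and> b = 0 \<and> c = 0"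
  proof (cases p)
    case None
    \<comment> \<open>Agreement at infinity kills the leading coefficient; the remaining linear
      polynomial has two distinct roots.\<close>
    then have "a = 0" using A(3) B(3) by (cases q3) (auto simp: a_def)
    then have bc: "b * z1 + c = 0" "b * z2 + c = 0"
      using root[OF A(1) B(1)] root[OF A(2) B(2)] by simp_all
    then have "b * (z1 - z2) = 0" by Groebner_Basis.algebra
    then show ?thesis using bc \<open>a = 0\<close> distinct(1) by simp
  next
    case (Some z3)
    then show ?thesis
      using quadratic_three_roots[OF _ _ _ root[OF A(1) B(1)] root[OF A(2) B(2)]
          root[OF A(3)[unfolded Some] B(3)[unfolded Some]]] distinct by auto
  qed
  then show ?thesis
    using proportional_det_one[OF det] by (simp add: a_def b_def c_def)
qed

section \<open>Explicit matrices for the face pairings\<close>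

text \<open>\<open>E\<close> is the Moebius map with \<open>1 \<mapsto> x\<close>, \<open>1 + x \<mapsto> x + w\<close>, \<open>x \<mapsto> 1 + x\<close>, scaled to have
  determinant 1 on \<open>V0\<close>.\<close>

definition link_matrix :: "complex \<Rightarrow> complex \<Rightarrow> pairing \<Rightarrow> mat2" where
  "link_matrix w x j =
     (let E = mat22 ((w + x - w * x) * x + w) (- (w + x - w * x) * x\<^sup>2 - w * (1 + x - x\<^sup>2))
                    (w + x - w * x) (- (w + x - w * x) * x - w * (1 - x))
      in case j of PA \<Rightarrow> mat22 1 1 0 1 | PB \<Rightarrow> mat22 1 1 0 1 | PC \<Rightarrow> mat22 1 (w + x) 0 1
                 | PD \<Rightarrow> E ** E | PE \<Rightarrow> E)"

text \<open>For \<open>PE\<close> the determinant expands to \<open>x (1 - x) w (1 - w)\<close>,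
  which is 1 on \<open>V0\<close>.\<close>

lemma det_link_matrix:
  assumes "(w, x) \<in> V0" shows "det (link_matrix w x j) = 1"
proof -
  have "1 - x * (1 - x) * w * (1 - w) = 0" using assms by (simp add: V0_def)
  then have "((w + x - w * x) * x + w) * (- (w + x - w * x) * x - w * (1 - x))
      - (- (w + x - w * x) * x\<^sup>2 - w * (1 + x - x\<^sup>2)) * (w + x - w * x) = 1"
    by Groebner_Basis.algebra
  then have E: "det (link_matrix w x PE) = 1"
    by (simp only: link_matrix_def Let_def det_2 mat22_entry pairing.case)
  show ?thesis
  proof (cases j)
    case PD
    then have "link_matrix w x j = link_matrix w x PE ** link_matrix w x PE"
      by (simp add: link_matrix_def Let_def)
    then show ?thesis using E by (simp add: det_mul)
  qed (use E in \<open>auto simp: link_matrix_def det_2\<close>)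
qed

text \<open>\<open>A\<close> takes the vector \<open>(z, 1)\<close> to \<open>r (y, 1)\<close>,
  where \<open>r\<close> may be 0. Multiplying the equation for \<open>B\<close> at \<open>y\<close>
  by \<open>r\<close> gives the one for the product, without any division.\<close>

lemma sends_mult:
  assumes "sends A (Some z) (Some y)" "sends B (Some y) (Some u)"
  shows "sends (B ** A) (Some z) (Some u)"
proof -
  define r where "r = entry A 2 1 * z + entry A 2 2"
  have 1: "entry A 1 1 * z + entry A 1 2 = y * r" using assms(1) by (simp add: r_def)
  have 2: "entry B 1 1 * y + entry B 1 2 = u * (entry B 2 1 * y + entry B 2 2)"
    using assms(2) by simp
  have "entry (B ** A) i 1 * z + entry (B ** A) i 2 = (entry B i 1 * y + entry B i 2) * r" for i
  proof -
    have "entry (B ** A) i 1 * z + entry (B ** A) i 2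
        = entry B i 1 * (entry A 1 1 * z + entry A 1 2) + entry B i 2 * r"
      by (simp add: mat2_mult_entry r_def algebra_simps)
    then show ?thesis unfolding 1 by (simp add: algebra_simps)
  qed
  then show ?thesis using 2 by simp
qed

lemma link_matrix_sends:
  assumes "(w, x) \<in> V0"
  shows "list_all2 (sends (link_matrix w x j)) (source_face w x j) (target_face w x j)"
proof -
  define E where "E = link_matrix w x PE"
  have E: "sends E (Some 1) (Some x)" "sends E (Some (1 + x)) (Some (x + w))"
    "sends E (Some x) (Some (1 + x))"
    by (simp_all add: E_def link_matrix_def algebra_simps power2_eq_square)
  \<comment> \<open>The image of 0 under \<open>E\<close> is not one of the known values, so this
    vertex cannot be reached by composition. Instead Cayley-Hamilton,
    \<open>E ** E = w x E - 1\<close>, gives the second column of the square, and the equation of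
    \<open>V0\<close> finishes.\<close>
  have "sends (E ** E) (Some 0) (Some (1 + x + w))"
  proof -
    have "det E = 1" unfolding E_def by (rule det_link_matrix[OF assms])
    moreover have tr: "entry E 1 1 + entry E 2 2 = w * x"
      by (simp add: E_def link_matrix_def algebra_simps)
    ultimately have "entry (E ** E) 1 2 = w * x * entry E 1 2"
      "entry (E ** E) 2 2 = w * x * entry E 2 2 - 1"
      unfolding mat2_mult_entry det_2 by Groebner_Basis.algebra+
    moreover have "1 - x * (1 - x) * w * (1 - w) = 0" using assms by (simp add: V0_def)
    then have "(w * x) * (- (w + x - w * x) * x\<^sup>2 - w * (1 + x - x\<^sup>2))
        = (1 + x + w) * ((w * x) * (- (w + x - w * x) * x - w * (1 - x)) - 1)"
      by Groebner_Basis.algebra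
    then have "w * x * entry E 1 2 = (1 + x + w) * (w * x * entry E 2 2 - 1)"
      by (simp only: E_def link_matrix_def Let_def mat22_entry pairing.case)
    ultimately show ?thesis by simp
  qed
  moreover have "link_matrix w x PD = E ** E" "link_matrix w x PE = E"
    by (simp_all add: E_def link_matrix_def Let_def)
  moreover have "sends (E ** E) (Some 1) (Some (1 + x))" "sends (E ** E) (Some x) (Some (x + w))"
    using sends_mult E by blast+
  ultimately show ?thesis
    using E by (cases j) (simp_all add: link_matrix_def del: sends.simps(4) flip: E_def,
      simp_all add: link_matrix_def)
qed

lemma pairs_faces_link_matrix:
  assumes "(w, x) \<in> V0" "pairs_faces w x j g"
  shows "g = pm (link_matrix w x j)"
proof -
  \<comment> \<open>Any of these equalities would turn the equation of \<open>V0\<close> into 1 = 0.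
    The inequalities make the vertices of each source face distinct.\<close>
  have ne: "x \<noteq> 0" "x \<noteq> 1" "w \<noteq> 0" using assms(1) by (auto simp: V0_def)
  have g: "g \<in> carrier PSL2" using assms(2) by (simp add: pairs_faces_def)
  \<comment> \<open>The very representative that \<open>sphere_act\<close> chooses.\<close>
  define A where "A = (SOME A. A \<in> g)"
  have "A \<in> g" unfolding A_def by (rule someI_ex) (use PSL2_obtain[OF g] in blast)
  note A = PSL2_memE[OF g this]
  have "map (moebius A) (source_face w x j) = target_face w x j"
    using assms(2) by (simp add: pairs_faces_def sphere_act_def A_def)
  then have s: "list_all2 (sends A) (source_face w x j) (target_face w x j)"
    by (metis (mono_tags, lifting) list_all2_map2 list.rel_refl moebius_sends)
  note u = sends_unique[OF _ _ A(1) det_link_matrix[OF assms(1)]]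
    and m = link_matrix_sends[OF assms(1), of j]
  have "A \<in> pm (link_matrix w x j)"
  proof (cases j)
    case PA
    show ?thesis using ne unfolding PA
      by (intro u[OF s[unfolded PA source_face.simps] m[unfolded PA source_face.simps]]) simp_all
  next
    case PB
    show ?thesis using ne unfolding PB
      by (intro u[OF s[unfolded PB source_face.simps] m[unfolded PB source_face.simps]]) simp_all
  next
    case PC
    show ?thesis using ne unfolding PC
      by (intro u[OF s[unfolded PC source_face.simps] m[unfolded PC source_face.simps]]) simp_all
  next
    case PD
    show ?thesis using ne unfolding PD
      by (intro u[OF s[unfolded PD source_face.simps] m[unfolded PD source_face.simps]]) simp_all
  next
    case PE
    show ?thesis using ne unfolding PE
      by (intro u[OF s[unfolded PE source_face.simps] m[unfolded PE source_face.simps]]) simp_all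
  qed
  then show ?thesis using A(2) by auto
qed

section \<open>A matrix algebra with traces in a given field\<close>

text \<open>The \<open>K\<close>-span of \<open>1, N, E, N E\<close>, where \<open>N\<close> has upper right entry 1 and zeros elsewhere.\<close>

definition parabolic_span :: "complex set \<Rightarrow> mat2 \<Rightarrow> mat2 set" where
  "parabolic_span K E = {mat22 (a + c * entry E 1 1 + d * entry E 2 1) (b + c * entry E 1 2 + d * entry E 2 2)
                               (c * entry E 2 1) (a + c * entry E 2 2)
                        | a b c d. a \<in> K \<and> b \<in> K \<and> c \<in> K \<and> d \<in> K}"

context
  fixes K E
  assumes K: "complex_subfield K"
    and det_E: "det E = 1" and trace_E: "trace E \<in> K" and E21: "entry E 2 1 \<in> K"
begin

lemma parabolic_span_mult:
  assumes "M \<in> parabolic_span K E" "M' \<in> parabolic_span K E"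
  shows "M ** M' \<in> parabolic_span K E"
proof -
  obtain a b c d where
    M: "M = mat22 (a + c * entry E 1 1 + d * entry E 2 1) (b + c * entry E 1 2 + d * entry E 2 2)
                               (c * entry E 2 1) (a + c * entry E 2 2)"
    and in_K: "a \<in> K" "b \<in> K" "c \<in> K" "d \<in> K"
    using assms(1) by (auto simp: parabolic_span_def)
  obtain a' b' c' d' where
    M': "M' = mat22 (a' + c' * entry E 1 1 + d' * entry E 2 1) (b' + c' * entry E 1 2 + d' * entry E 2 2)
                               (c' * entry E 2 1) (a' + c' * entry E 2 2)"
    and in_K': "a' \<in> K" "b' \<in> K" "c' \<in> K" "d' \<in> K"
    using assms(2) by (auto simp: parabolic_span_def)
  define s t where "s = entry E 2 1" and "t = trace E"
  have t: "t = entry E 1 1 + entry E 2 2" by (simp add: t_def mat2_trace)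
  have det: "entry E 1 1 * entry E 2 2 - entry E 1 2 * entry E 2 1 = 1"
    using det_E by (simp add: det_2)
  \<comment> \<open>The coordinates of the product in the basis \<open>1, N, E, N E\<close>,
    obtained by reducing with the identities for \<open>N N\<close>, \<open>E E\<close> and
    \<open>E N\<close>; these also give \<open>E N E = s E + N\<close> and
    \<open>N E N = s N\<close>.\<close>
  define k1 where "k1 = a * a' + s * c * b' - c * c'"
  define k2 where "k2 = a * b' + b * a' + t * c * b' + c * d' + s * d * b' - d * c'"
  define k3 where "k3 = a * c' + c * a' + t * c * c' + s * c * d'"
  define k4 where "k4 = a * d' + b * c' - c * b' + d * a' + t * d * c' + s * d * d'"
  have "k1 \<in> K" "k2 \<in> K" "k3 \<in> K" "k4 \<in> K"
    unfolding k1_def k2_def k3_def k4_def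
    using in_K in_K' E21 trace_E unfolding s_def t_def
    by (simp_all add: subfield_closed[OF K])
  moreover have "M ** M' = mat22 (k1 + k3 * entry E 1 1 + k4 * entry E 2 1)
       (k2 + k3 * entry E 1 2 + k4 * entry E 2 2) (k3 * entry E 2 1) (k1 + k3 * entry E 2 2)"
    unfolding M M' mat2_eq_iff mat2_mult_entry mat22_entry k1_def k2_def k3_def k4_def s_def t
  proof (intro conjI)
    \<comment> \<open>The lower left entries agree identically; the other three need
      \<open>det E = 1\<close>.\<close>
    show "c * entry E 2 1 * (a' + c' * entry E 1 1 + d' * entry E 2 1)
          + (a + c * entry E 2 2) * (c' * entry E 2 1)
        = (a * c' + c * a' + (entry E 1 1 + entry E 2 2) * c * c' + entry E 2 1 * c * d') * entry E 2 1"
      by (simp add: algebra_simps)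
  qed (use det in Groebner_Basis.algebra)+
  ultimately show ?thesis unfolding parabolic_span_def by blast
qed

text \<open>The adjugate is the scalar matrix \<open>trace M\<close> minus \<open>M\<close>, so its
  first coordinate is \<open>trace M - a\<close> and the other three change sign.\<close>

lemma parabolic_span_adj2:
  assumes "M \<in> parabolic_span K E" shows "adj2 M \<in> parabolic_span K E"
proof -
  obtain a b c d where
    M: "M = mat22 (a + c * entry E 1 1 + d * entry E 2 1) (b + c * entry E 1 2 + d * entry E 2 2)
                               (c * entry E 2 1) (a + c * entry E 2 2)"
    and in_K: "a \<in> K" "b \<in> K" "c \<in> K" "d \<in> K"
    using assms(1) by (auto simp: parabolic_span_def)
  define k where "k = a + c * trace E + d * entry E 2 1"
  have "k \<in> K" "- b \<in> K" "- c \<in> K" "- d \<in> K"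
    unfolding k_def using in_K E21 trace_E
    by (simp_all add: subfield_closed[OF K])
  moreover have "adj2 M = mat22 (k + (- c) * entry E 1 1 + (- d) * entry E 2 1)
       (- b + (- c) * entry E 1 2 + (- d) * entry E 2 2) ((- c) * entry E 2 1) (k + (- c) * entry E 2 2)"
    by (simp add: M adj2_def mat2_eq_iff k_def mat2_trace algebra_simps)
  ultimately show ?thesis unfolding parabolic_span_def by blast
qed

lemma parabolic_span_uminus:
  assumes "M \<in> parabolic_span K E" shows "- M \<in> parabolic_span K E"
proof -
  obtain a b c d where
    M: "M = mat22 (a + c * entry E 1 1 + d * entry E 2 1) (b + c * entry E 1 2 + d * entry E 2 2)
                               (c * entry E 2 1) (a + c * entry E 2 2)"
    and in_K: "a \<in> K" "b \<in> K" "c \<in> K" "d \<in> K"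
    using assms(1) by (auto simp: parabolic_span_def)
  have "- a \<in> K" "- b \<in> K" "- c \<in> K" "- d \<in> K"
    using in_K by (simp_all add: subfield_uminus[OF K])
  moreover have "- M = mat22 (- a + (- c) * entry E 1 1 + (- d) * entry E 2 1)
       (- b + (- c) * entry E 1 2 + (- d) * entry E 2 2) ((- c) * entry E 2 1) (- a + (- c) * entry E 2 2)"
    by (simp add: M mat2_eq_iff algebra_simps)
  ultimately show ?thesis unfolding parabolic_span_def by blast
qed

lemma translation_in_parabolic_span:
  assumes "b \<in> K" shows "mat22 1 b 0 1 \<in> parabolic_span K E"
  unfolding parabolic_span_def
  by (intro CollectI exI[of _ 1] exI[of _ b] exI[of _ 0])
     (use assms subfield_one[OF K] subfield_zero[OF K] in auto)

lemma generator_in_parabolic_span: "E \<in> parabolic_span K E"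
  unfolding parabolic_span_def
  by (rule CollectI, rule exI[of _ 0], rule exI[of _ 0], rule exI[of _ 1], rule exI[of _ 0])
     (use subfield_one[OF K] subfield_zero[OF K] in \<open>auto simp: mat2_eq_iff\<close>)

text \<open>The basis \<open>1, N, E, N E\<close> has traces 2, 0, \<open>trace E\<close> and
  \<open>entry E 2 1\<close>, all in \<open>K\<close>.\<close>

lemma trace_in_parabolic_span:
  assumes "M \<in> parabolic_span K E" shows "trace M \<in> K"
proof -
  obtain a b c d where
    M: "M = mat22 (a + c * entry E 1 1 + d * entry E 2 1) (b + c * entry E 1 2 + d * entry E 2 2)
                               (c * entry E 2 1) (a + c * entry E 2 2)"
    and in_K: "a \<in> K" "b \<in> K" "c \<in> K" "d \<in> K"
    using assms(1) by (auto simp: parabolic_span_def)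
  have "trace M = a + a + c * trace E + d * entry E 2 1"
    by (simp add: M mat2_trace algebra_simps)
  also have "\<dots> \<in> K"
    using in_K E21 trace_E by (intro subfield_add[OF K] subfield_mult[OF K])
  finally show ?thesis .
qed

text \<open>Reduces a statement about the whole holonomy group to one about its generators.\<close>

lemma subgroup_parabolic_span:
  "subgroup {g \<in> carrier PSL2. g \<subseteq> parabolic_span K E} PSL2"
proof (rule PSL2.subgroupI)
  have "mat 1 = mat22 1 0 0 1"
    by (simp add: mat2_eq_iff mat2_one_entry)
  then have "mat 1 \<in> parabolic_span K E"
    using translation_in_parabolic_span subfield_zero[OF K] by metis
  then have "\<one>\<^bsub>PSL2\<^esub> \<in> {g \<in> carrier PSL2. g \<subseteq> parabolic_span K E}"
    using parabolic_span_uminus by (simp add: PSL2_one pm_in_PSL2)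
  then show "{g \<in> carrier PSL2. g \<subseteq> parabolic_span K E} \<noteq> {}" by blast
next
  fix g assume "g \<in> {g \<in> carrier PSL2. g \<subseteq> parabolic_span K E}"
  moreover from this obtain A where "det A = 1" "g = pm A" by (auto elim: PSL2_obtain)
  ultimately show "inv\<^bsub>PSL2\<^esub> g \<in> {g \<in> carrier PSL2. g \<subseteq> parabolic_span K E}"
    using parabolic_span_adj2[of A] parabolic_span_uminus[of "adj2 A"]
    by (simp add: PSL2_inv pm_in_PSL2)
next
  fix g g' assume g: "g \<in> {g \<in> carrier PSL2. g \<subseteq> parabolic_span K E}"
    "g' \<in> {g \<in> carrier PSL2. g \<subseteq> parabolic_span K E}"
  obtain A B where "det A = 1" "g = pm A" "det B = 1" "g' = pm B"
    using g by (auto elim!: PSL2_obtain)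
  then show "g \<otimes>\<^bsub>PSL2\<^esub> g' \<in> {g \<in> carrier PSL2. g \<subseteq> parabolic_span K E}"
    using g parabolic_span_mult[of A B] parabolic_span_uminus[of "A ** B"]
    by (simp add: PSL2_mult pm_in_PSL2 det_mul)
qed auto

end

section \<open>Conjugation invariance\<close>

definition PSL2_conj :: "mat2 set \<Rightarrow> mat2 set \<Rightarrow> mat2 set" where
  "PSL2_conj h g = h \<otimes>\<^bsub>PSL2\<^esub> g \<otimes>\<^bsub>PSL2\<^esub> inv\<^bsub>PSL2\<^esub> h"

lemma PSL2_conj_mult:
  assumes "h \<in> carrier PSL2" "g \<in> carrier PSL2" "g' \<in> carrier PSL2"
  shows "PSL2_conj h (g \<otimes>\<^bsub>PSL2\<^esub> g') = PSL2_conj h g \<otimes>\<^bsub>PSL2\<^esub> PSL2_conj h g'"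
proof -
  have "inv\<^bsub>PSL2\<^esub> h \<otimes>\<^bsub>PSL2\<^esub> (h \<otimes>\<^bsub>PSL2\<^esub> y) = y" if "y \<in> carrier PSL2" for y
    using assms(1) that by (simp flip: PSL2.m_assoc)
  then show ?thesis using assms by (simp add: PSL2_conj_def PSL2.m_assoc)
qed

lemma group_hom_PSL2_conj:
  assumes "h \<in> carrier PSL2" shows "group_hom PSL2 PSL2 (PSL2_conj h)"
  by (intro group_hom.intro group_hom_axioms.intro group_PSL2 homI PSL2_conj_mult assms)
     (use assms in \<open>auto simp: PSL2_conj_def\<close>)

lemma trace_image_PSL2_conj:
  assumes "h \<in> carrier PSL2" "g \<in> carrier PSL2"
  shows "trace ` PSL2_conj h g = trace ` g"
proof -
  obtain H A where HA: "det H = 1" "h = pm H" "g = pm A"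
    using assms by (auto elim!: PSL2_obtain)
  then have "PSL2_conj h g = pm (H ** A ** adj2 H)"
    by (simp add: PSL2_conj_def PSL2_inv PSL2_mult)
  moreover have "trace (H ** A ** adj2 H) = trace A"
  proof -
    have "trace (H ** A ** adj2 H) = trace (adj2 H ** (H ** A))"
      by (rule trace_mul_sym)
    then show ?thesis using HA(1) by (simp add: matrix_mul_assoc adj2_mult)
  qed
  moreover have "trace (- M) = - trace M" for M :: mat2 by (simp add: mat2_trace)
  ultimately show ?thesis by (simp add: HA)
qed

lemma trace_field_alt: "trace_field \<Gamma> = adjoin_rat (\<Union>g\<in>\<Gamma>. trace ` g)"
proof -
  have "{trace A | A g. g \<in> \<Gamma> \<and> A \<in> g} = (\<Union>g\<in>\<Gamma>. trace ` g)" by blast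
  then show ?thesis by (simp add: trace_field_def)
qed

lemma trace_field_PSL2_conj:
  assumes "h \<in> carrier PSL2" "\<Gamma> \<subseteq> carrier PSL2"
  shows "trace_field (PSL2_conj h ` \<Gamma>) = trace_field \<Gamma>"
proof -
  have "(\<Union>g\<in>\<Gamma>. trace ` PSL2_conj h g) = (\<Union>g\<in>\<Gamma>. trace ` g)"
    using assms by (intro SUP_cong refl trace_image_PSL2_conj) auto
  then show ?thesis by (simp add: trace_field_alt)
qed

text \<open>Conjugation is a homomorphism, so it carries squares to squares and the group they
  generate to its conjugate.\<close>

lemma invariant_trace_field_PSL2_conj:
  assumes "h \<in> carrier PSL2" "\<Gamma> \<subseteq> carrier PSL2"
  shows "invariant_trace_field (PSL2_conj h ` \<Gamma>) = invariant_trace_field \<Gamma>"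
proof -
  interpret c: group_hom PSL2 PSL2 "PSL2_conj h" by (rule group_hom_PSL2_conj[OF assms(1)])
  let ?S = "(\<lambda>g. g \<otimes>\<^bsub>PSL2\<^esub> g) ` \<Gamma>"
  have S: "?S \<subseteq> carrier PSL2" using assms(2) by auto
  have "(\<lambda>g. g \<otimes>\<^bsub>PSL2\<^esub> g) ` PSL2_conj h ` \<Gamma> = PSL2_conj h ` ?S"
    using assms by (auto simp: image_image PSL2_conj_mult subset_iff intro!: image_cong)
  then have "generate PSL2 ((\<lambda>g. g \<otimes>\<^bsub>PSL2\<^esub> g) ` PSL2_conj h ` \<Gamma>) = PSL2_conj h ` generate PSL2 ?S"
    using c.generate_img[OF S] by simp
  then show ?thesis
    using trace_field_PSL2_conj[OF assms(1) PSL2.generate_incl[OF S]]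
    by (simp add: invariant_trace_field_def Setcompr_eq_image)
qed

text \<open>Needed because \<open>determines\<close> describes the holonomy only up to conjugation
  by some \<open>h\<close>.\<close>

lemma holonomy_group_PSL2_conj:
  assumes "h \<in> carrier PSL2" "range \<phi> \<subseteq> carrier PSL2"
  shows "holonomy_group (\<lambda>j. PSL2_conj h (\<phi> j)) = PSL2_conj h ` holonomy_group \<phi>"
proof -
  interpret c: group_hom PSL2 PSL2 "PSL2_conj h" by (rule group_hom_PSL2_conj[OF assms(1)])
  show ?thesis
    using c.generate_img[OF assms(2)] by (simp add: holonomy_group_def image_image)
qed

section \<open>The trace fields of the filling\<close>

lemma trace_fields_parabolic_span:
  assumes "complex_subfield K" "det E = 1" "trace E \<in> K" "entry E 2 1 \<in> K"
    and "subgroup \<Gamma> PSL2" "\<And>g. g \<in> \<Gamma> \<Longrightarrow> g \<subseteq> parabolic_span K E"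
  shows "trace_field \<Gamma> \<subseteq> K" "invariant_trace_field \<Gamma> \<subseteq> K"
proof -
  have *: "trace_field \<Delta> \<subseteq> K" if "\<Delta> \<subseteq> \<Gamma>" for \<Delta>
    unfolding trace_field_alt
    by (rule adjoin_rat_minimal[OF assms(1)])
       (use that assms(6) trace_in_parabolic_span[OF assms(1-4)] in blast)
  from *[of \<Gamma>] show "trace_field \<Gamma> \<subseteq> K" by simp
  \<comment> \<open>Squares stay in the group, so the bound on traces covers the invariant trace
    field as well.\<close>
  have "generate PSL2 {g \<otimes>\<^bsub>PSL2\<^esub> g | g. g \<in> \<Gamma>} \<subseteq> \<Gamma>"
    by (rule PSL2.generate_subgroup_incl[OF _ assms(5)])
       (use subgroup.m_closed[OF assms(5)] in auto)
  then show "invariant_trace_field \<Gamma> \<subseteq> K"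
    unfolding invariant_trace_field_def by (rule *)
qed

lemma trace_in_trace_field: "g \<in> \<Gamma> \<Longrightarrow> A \<in> g \<Longrightarrow> trace A \<in> trace_field \<Gamma>"
  unfolding trace_field_def by (rule subsetD[OF adjoin_rat_incl]) blast

text \<open>Multiplying \<open>E\<^sup>2\<close> by the square of the unit translation changes its trace by twice its
  lower left entry, which is \<open>entry E 2 1 * trace E\<close>.\<close>

lemma lower_left_trace_in_invariant_trace_field:
  assumes "det E = 1" "pm (mat22 1 1 0 1) \<in> \<Gamma>" "pm E \<in> \<Gamma>"
  shows "entry E 2 1 * trace E \<in> invariant_trace_field \<Gamma>"
proof -
  define T where "T = mat22 1 1 0 1"
  let ?S = "{g \<otimes>\<^bsub>PSL2\<^esub> g | g. g \<in> \<Gamma>}"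
  let ?L = "invariant_trace_field \<Gamma>"
  have L: "complex_subfield ?L"
    by (simp add: invariant_trace_field_def trace_field_def subfield_adjoin_rat)
  have "pm (E ** E) \<in> ?S" "pm (T ** T) \<in> ?S"
    using assms(2,3) unfolding T_def PSL2_mult[symmetric] by blast+
  then have *: "pm (E ** E) \<in> generate PSL2 ?S" "pm (T ** T) \<in> generate PSL2 ?S"
    by (auto intro: generate.incl)
  then have "pm (T ** T ** (E ** E)) \<in> generate PSL2 ?S"
    unfolding PSL2_mult[of "T ** T", symmetric] by (intro generate.eng)
  with * have in_L: "trace (E ** E) \<in> ?L" "trace (T ** T ** (E ** E)) \<in> ?L"
    unfolding invariant_trace_field_def by (auto intro: trace_in_trace_field)
  have "trace (T ** T ** (E ** E)) - trace (E ** E) = 2 * (entry E 2 1 * trace E)"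
    by (simp add: mat2_trace mat2_mult_entry T_def algebra_simps)
  \<comment> \<open>Writing 2 as \<open>1 + 1\<close> lets the closure rules of a subfield
    apply.\<close>
  then have "entry E 2 1 * trace E
      = (trace (T ** T ** (E ** E)) - trace (E ** E)) / (1 + 1)"
    by simp
  also have "\<dots> \<in> ?L"
    by (intro subfield_closed[OF L] in_L)
  finally show ?thesis .
qed

lemma trace_fields_link_group:
  assumes "(w, x) \<in> V0"
  defines "\<Gamma> \<equiv> holonomy_group (\<lambda>j. pm (link_matrix w x j))"
  shows "trace_field \<Gamma> = adjoin_rat {w * x}" "invariant_trace_field \<Gamma> = adjoin_rat {w * x}"
proof -
  define E where "E = link_matrix w x PE"
  define K where "K = adjoin_rat {w * x}"
  have V: "1 - x * (1 - x) * w * (1 - w) = 0" and ne: "w * x \<noteq> 0"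
    using assms(1) by (auto simp: V0_def)
  have K: "complex_subfield K" unfolding K_def by (rule subfield_adjoin_rat)
  have wx: "w * x \<in> K" using adjoin_rat_incl[of "{w * x}"] by (simp add: K_def)
  have det_E: "det E = 1" unfolding E_def by (rule det_link_matrix[OF assms(1)])
  have trace_E: "trace E = w * x"
    by (simp add: E_def link_matrix_def mat2_trace algebra_simps)
  have E21: "entry E 2 1 = w + x - w * x" by (simp add: E_def link_matrix_def)
  \<comment> \<open>With \<open>s = w + x - w x\<close> one has
    \<open>(1 - w)(1 - x) = 1 - s\<close>, so \<open>V0\<close> reads
    \<open>w x (1 - s) = 1\<close>.\<close>
  have rel: "(w + x - w * x) * (w * x) = w * x - 1" using V by Groebner_Basis.algebra
  then have "w + x - w * x = (w * x - 1) / (w * x)" using ne by (simp add: field_simps)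
  also have "\<dots> \<in> K" by (intro subfield_closed[OF K] wx)
  finally have s: "w + x - w * x \<in> K" .
  \<comment> \<open>The translation length of \<open>PC\<close>, needed to place that generator in
    the span.\<close>
  then have "(w + x - w * x) + w * x \<in> K" using wx by (rule subfield_add[OF K])
  then have wx_sum: "w + x \<in> K" by simp
  note hyps = K det_E trace_E[THEN ssubst, of "\<lambda>t. t \<in> K", OF wx]
    E21[THEN ssubst, of "\<lambda>t. t \<in> K", OF s]
  have carrier: "range (\<lambda>j. pm (link_matrix w x j)) \<subseteq> carrier PSL2"
    using det_link_matrix[OF assms(1)] by (auto intro: pm_in_PSL2)
  have "link_matrix w x j \<in> parabolic_span K E" for j
  proof (cases j)
    case PD
    then have "link_matrix w x j = E ** E" by (simp add: E_def link_matrix_def Let_def)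
    then show ?thesis
      using parabolic_span_mult[OF hyps] generator_in_parabolic_span[OF hyps] by simp
  next
    case PE
    then show ?thesis using generator_in_parabolic_span[OF hyps] by (simp add: E_def)
  qed (use translation_in_parabolic_span[OF hyps] wx_sum subfield_one[OF K]
        in \<open>auto simp: link_matrix_def\<close>)
  then have "range (\<lambda>j. pm (link_matrix w x j)) \<subseteq> {g \<in> carrier PSL2. g \<subseteq> parabolic_span K E}"
    using carrier parabolic_span_uminus[OF hyps] by auto
  then have "\<Gamma> \<subseteq> {g \<in> carrier PSL2. g \<subseteq> parabolic_span K E}"
    unfolding \<Gamma>_def holonomy_group_def
    by (rule PSL2.generate_subgroup_incl[OF _ subgroup_parabolic_span[OF hyps]])
  then have span: "\<And>g. g \<in> \<Gamma> \<Longrightarrow> g \<subseteq> parabolic_span K E" by auto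
  have sub: "subgroup \<Gamma> PSL2"
    unfolding \<Gamma>_def holonomy_group_def by (rule PSL2.generate_is_subgroup[OF carrier])
  have gens: "pm (link_matrix w x j) \<in> \<Gamma>" for j
    unfolding \<Gamma>_def holonomy_group_def by (auto intro: generate.incl)
  have "w * x \<in> trace_field \<Gamma>"
    using trace_in_trace_field[OF gens[of PE], of E] by (simp add: E_def[symmetric] trace_E)
  then have "K \<subseteq> trace_field \<Gamma>"
    unfolding K_def by (intro adjoin_rat_minimal) (simp_all add: trace_field_def subfield_adjoin_rat)
  then show "trace_field \<Gamma> = adjoin_rat {w * x}"
    using trace_fields_parabolic_span(1)[OF hyps sub span] by (simp add: K_def)
  have L: "complex_subfield (invariant_trace_field \<Gamma>)"
    by (simp add: invariant_trace_field_def trace_field_def subfield_adjoin_rat)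
  \<comment> \<open>By \<open>rel\<close> this is \<open>entry E 2 1 * trace E\<close>, which
    squares of group elements already detect.\<close>
  have "w * x - 1 \<in> invariant_trace_field \<Gamma>"
    using lower_left_trace_in_invariant_trace_field[OF det_E, of \<Gamma>] gens[of PA] gens[of PE]
    by (simp add: E_def[symmetric] trace_E E21 rel) (simp add: link_matrix_def)
  then have "(w * x - 1) + 1 \<in> invariant_trace_field \<Gamma>"
    using subfield_one[OF L] by (rule subfield_add[OF L])
  then have "K \<subseteq> invariant_trace_field \<Gamma>"
    unfolding K_def by (intro adjoin_rat_minimal L) simp
  then show "invariant_trace_field \<Gamma> = adjoin_rat {w * x}"
    using trace_fields_parabolic_span(2)[OF hyps sub span] by (simp add: K_def)
qed

theorem proposition6p16:
  fixes p q :: nat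
    and \<phi> :: "pairing \<Rightarrow> mat2 set"
    and F :: "point \<Rightarrow> point"
    and \<sigma>1 \<sigma>2 :: complex
  assumes "p \<noteq> 0 \<or> q \<noteq> 0"
    and "complete_filling p q \<phi> F"
    and "sigma_determines \<sigma>1 \<sigma>2 \<phi> F"
  shows "invariant_trace_field (holonomy_group \<phi>) = adjoin_rat {\<sigma>2}
       \<and> trace_field (holonomy_group \<phi>) = adjoin_rat {\<sigma>2}"
proof -
  obtain w x h where V0: "(w, x) \<in> V0" and \<sigma>2: "\<sigma>2 = w * x" and h: "h \<in> carrier PSL2"
    and pairs: "\<And>j. pairs_faces w x j (PSL2_conj h (\<phi> j))"
    using assms(3) by (auto simp: sigma_determines_def determines_def PSL2_conj_def)
  have \<phi>: "range \<phi> \<subseteq> carrier PSL2" using assms(2) by (simp add: complete_filling_def)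
  \<comment> \<open>Each conjugated generator is pinned down by its values on three ideal vertices,
    so the holonomy group is conjugate to the explicit one.\<close>
  have "PSL2_conj h (\<phi> j) = pm (link_matrix w x j)" for j
    by (rule pairs_faces_link_matrix[OF V0 pairs])
  then have conj: "holonomy_group (\<lambda>j. pm (link_matrix w x j)) = PSL2_conj h ` holonomy_group \<phi>"
    using holonomy_group_PSL2_conj[OF h \<phi>] by simp
  have \<Gamma>: "holonomy_group \<phi> \<subseteq> carrier PSL2"
    unfolding holonomy_group_def by (rule PSL2.generate_incl[OF \<phi>])
  show ?thesis
    using trace_fields_link_group[OF V0] trace_field_PSL2_conj[OF h \<Gamma>]
      invariant_trace_field_PSL2_conj[OF h \<Gamma>]
    by (simp add: conj \<sigma>2)
qed

end
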